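(* Let $v,k,\lambda,\mu$ be integers and let $C=[c_{ij}]$ be a $t\times t$ column orbit matrix for a strongly regular graph with parameters $(v,k,\lambda,\mu)$ and orbit length distribution $(n_1,\ldots,n_t)$ with $n_1=\cdots=n_t=n$. Suppose all diagonal entries of $C$ are equal, and the off-diagonal entries of $C$ take exactly two values $x\neq y$ (i.e. $c_{ij}\in\{x,y\}$ for all $i\neq j$). Then the $t\times t$ matrix obtained from $C$ by replacing every off-diagonal entry equal to $x$ by $1$, every off-diagonal entry equal to $y$ by $0$, and every diagonal entry by $0$, is the adjacency matrix of a strongly regular graph on $t$ vertices.
   Context: Given positive integers $n_1,\ldots,n_t$ (orbit lengths) with $\sum_i n_i=v$, a $t\times t$ matrix $C=[c_{ij}]$ is called a column orbit matrix for a strongly regular graph with parameters $(v,k,\lambda,\mu)$ and orbit length distribution $(n_1,\ldots,n_t)$ if for all $i,j$: $\sum_{i=1}^t c_{ij}=\sum_{j=1}^t \frac{n_j}{n_i}c_{ij}=k$, and $\sum_{s=1}^t \frac{n_s}{n_j}c_{is}c_{js}=\delta_{ij}(k-\mu)+\mu n_i+(\lambda-\mu)c_{ij}$, where $\delta_{ij}$ is the Kronecker delta. (Such matrices arise, e.g., when $c_{ij}$ is the column sum of the block of the adjacency matrix of a strongly regular graph indexed by vertex orbits $O_i$ versus $O_j$ of an automorphism group.) A strongly regular graph with parameters $(v,k,\lambda,\mu)$ is a $k$-regular graph on $v$ vertices where adjacent vertices have $\lambda$ and distinct non-adjacent vertices have $\mu$ common neighbours.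
   Formalization: When λ=μ, C is additionally assumed symmetric; otherwise the claim fails, e.g. for the circulant Fano-plane incidence matrix (t=v=7, n=1, c_ij=1 iff j−i mod 7 is in {1,2,4}, k=3, λ=μ=1), which is not symmetric. *)

theory Defs
  imports "HOL-Analysis.Analysis"
begin

(* The parameters v, k, lam, mu are arbitrary integers: no strongly regular graph with these
   parameters is required to exist. Symmetry of C is not required either. The last condition,
   whose left-hand side is symmetric in i and j when all orbit lengths agree, forces it
   when lam \<noteq> mu, but not when lam = mu: the circulant incidence matrix of the Fano plane with
   rows {1,2,4} + i modulo 7 is a non-symmetric column orbit matrix for (7,3,1,1) with n i = 1. *)
definition column_orbit_matrix ::
    "int \<Rightarrow> int \<Rightarrow> int \<Rightarrow> int \<Rightarrow> ('t::finite \<Rightarrow> nat) \<Rightarrow> real^'t^'t \<Rightarrow> bool" where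
  "column_orbit_matrix v k lam mu n C \<longleftrightarrow>
     (\<forall>i. n i > 0) \<and>
     (\<Sum>i\<in>UNIV. int (n i)) = v \<and>
     (\<forall>j. (\<Sum>i\<in>UNIV. C $ i $ j) = of_int k) \<and>
     (\<forall>i. (\<Sum>j\<in>UNIV. real (n j) / real (n i) * C $ i $ j) = of_int k) \<and>
     (\<forall>i j. (\<Sum>s\<in>UNIV. real (n s) / real (n j) * C $ i $ s * C $ j $ s) =
        (if i = j then of_int (k - mu) else 0) + of_int mu * real (n i)
          + of_int (lam - mu) * C $ i $ j)"

(* Simple graphs on the finite vertex type 'a are given by their adjacency relation.
   Complete and empty graphs are not excluded. *)
definition strongly_regular ::
    "('a::finite \<Rightarrow> 'a \<Rightarrow> bool) \<Rightarrow> nat \<Rightarrow> nat \<Rightarrow> nat \<Rightarrow> nat \<Rightarrow> bool" where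
  "strongly_regular E v k lam mu \<longleftrightarrow>
     symp E \<and> irreflp E \<and>
     CARD('a) = v \<and>
     (\<forall>a. card {b. E a b} = k) \<and>
     (\<forall>a b. E a b \<longrightarrow> card {c. E a c \<and> E b c} = lam) \<and>
     (\<forall>a b. a \<noteq> b \<and> \<not> E a b \<longrightarrow> card {c. E a c \<and> E b c} = mu)"

definition adjacency_matrix :: "('a::finite \<Rightarrow> 'a \<Rightarrow> bool) \<Rightarrow> real^'a^'a" where
  "adjacency_matrix E = (\<chi> i j. if E i j then 1 else 0)"

definition replace_entries :: "real \<Rightarrow> real \<Rightarrow> real^'t^'t \<Rightarrow> real^'t^'t" where
  "replace_entries x y C =
     (\<chi> i j. if i = j then 0
            else if C $ i $ j = x then 1
            else if C $ i $ j = y then 0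
            else C $ i $ j)"

end

theory Submission imports Defs begin

(* Write a = y - d, where d is the common diagonal entry. Then C = (x - y) A - a I + y J with A the
   replaced matrix. The orbit matrix identities express the row sums of A and, through the entries
   of C C^T, the off-diagonal entries of A A^T, which count common neighbours; the latter depend
   only on the corresponding entry of C. *)

text \<open>The counts in the main proof come out as real quotients. A real equal to a cardinality
  is a natural number, so \<open>nat\<close> of its floor recovers it. If no pair is adjacent, or no
  distinct pair is non-adjacent, the corresponding parameter is unconstrained and any natural number
  serves.\<close>

lemma strongly_regularI_real:
  fixes E :: "'a::finite \<Rightarrow> 'a \<Rightarrow> bool" and r p q :: real
  assumes "symp E" and "irreflp E"
    and deg: "\<And>a. real (card {b. E a b}) = r"
    and adj: "\<And>a b. E a b \<Longrightarrow> real (card {c. E a c \<and> E b c}) = p"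
    and nonadj: "\<And>a b. a \<noteq> b \<Longrightarrow> \<not> E a b \<Longrightarrow> real (card {c. E a c \<and> E b c}) = q"
  shows "strongly_regular E CARD('a) (nat \<lfloor>r\<rfloor>) (nat \<lfloor>p\<rfloor>) (nat \<lfloor>q\<rfloor>)"
proof -
  have "m = nat \<lfloor>z\<rfloor>" if "real m = z" for m z
    using that by auto
  then show ?thesis
    unfolding strongly_regular_def using assms by blast
qed

lemma card_eq_sum_of_bool:
  fixes P :: "'a::finite \<Rightarrow> bool"
  shows "real (card {a. P a}) = (\<Sum>a\<in>UNIV. of_bool (P a))"
  by (simp add: of_bool_def flip: sum.inter_filter)

text \<open>Meant for \<open>f\<close> and \<open>g\<close> the rows \<open>i\<close> and
  \<open>j\<close> of C, so that the factors become entries of \<open>c\<close> times the replaced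
  matrix. As \<open>i \<noteq> j\<close>, the two diagonal corrections never meet and no
  \<open>a\<^sup>2\<close> term arises.\<close>

lemma sum_shifted_product:
  fixes f g :: "'t::finite \<Rightarrow> real"
  assumes "i \<noteq> j"
  shows "(\<Sum>s\<in>UNIV. (f s + a * of_bool (s = i) - y) * (g s + a * of_bool (s = j) - y)) =
    (\<Sum>s\<in>UNIV. f s * g s) + a * f j + a * g i
      - y * (\<Sum>s\<in>UNIV. f s) - y * (\<Sum>s\<in>UNIV. g s) - 2 * a * y + y\<^sup>2 * real CARD('t)"
proof -
  have "(f s + a * of_bool (s = i) - y) * (g s + a * of_bool (s = j) - y) =
      f s * g s + (if s = j then a * f s else 0) + (if s = i then a * g s else 0)
      - y * f s - y * g s - (if s = i then a * y else 0) - (if s = j then a * y else 0) + y\<^sup>2"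
    for s
    using assms by (auto simp: algebra_simps power2_eq_square)
  then show ?thesis
    by (simp add: sum.distrib sum_subtractf sum_distrib_left)
qed

theorem theorem4:
  fixes v k lam mu :: int
    and ns :: "'t::finite \<Rightarrow> nat"
    and n :: nat
    and C :: "real^'t^'t"
    and x y :: real
  assumes "column_orbit_matrix v k lam mu ns C"
    and "\<forall>i. ns i = n"
    and "\<forall>i j. C $ i $ i = C $ j $ j"
    and "x \<noteq> y"
    and "{C $ i $ j | i j. i \<noteq> j} = {x, y}"
    and "lam = mu \<Longrightarrow> transpose C = C"
  shows "\<exists>E k' lam' mu'. strongly_regular E CARD('t) k' lam' mu' \<and>
           replace_entries x y C = adjacency_matrix E"
proof -
  have npos: "n > 0"
    using assms(1,2) unfolding column_orbit_matrix_def by auto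
  \<comment> \<open>Equal positive orbit lengths turn every ratio of lengths into 1.\<close>
  have row: "(\<Sum>j\<in>UNIV. C $ i $ j) = of_int k" for i
    using assms(1,2) npos unfolding column_orbit_matrix_def by simp
  have gram: "(\<Sum>s\<in>UNIV. C $ i $ s * C $ j $ s) =
      of_int mu * real n + of_int (lam - mu) * C $ i $ j" if "i \<noteq> j" for i j
    using assms(1,2) npos that unfolding column_orbit_matrix_def by simp
  have sym: "C $ i $ j = C $ j $ i" for i j
  proof (cases "lam = mu \<or> i = j")
    case True
    moreover have "transpose C $ j $ i = C $ i $ j"
      by (simp add: transpose_def)
    ultimately show ?thesis using assms(6) by auto
  next
    case False
    have "(\<Sum>s\<in>UNIV. C $ i $ s * C $ j $ s) = (\<Sum>s\<in>UNIV. C $ j $ s * C $ i $ s)"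
      by (simp add: mult.commute)
    with gram[of i j] gram[of j i] False show ?thesis by simp
  qed
  have vals: "C $ i $ j = x \<or> C $ i $ j = y" if "i \<noteq> j" for i j
    using assms(5) that by blast
  obtain d where diag: "C $ i $ i = d" for i
    using assms(3) by blast
  define E where "E i j \<longleftrightarrow> i \<noteq> j \<and> C $ i $ j = x" for i j
  define a where "a = y - d"
  define c where "c = x - y"
  have c: "c \<noteq> 0" using assms(4) by (simp add: c_def)
  \<comment> \<open>On the diagonal the right-hand side is \<open>d + a - y\<close>, which the
    choice of \<open>a\<close> makes 0; off the diagonal it is \<open>x - y\<close> or 0.\<close>
  have entry: "c * of_bool (E i j) = C $ i $ j + a * of_bool (j = i) - y" for i j
    using vals[of i j] diag[of i] by (auto simp: E_def a_def c_def)
  have deg: "real (card {j. E i j}) = (of_int k + a - y * real CARD('t)) / c" for i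
  proof -
    have "c * real (card {j. E i j}) = (\<Sum>j\<in>UNIV. C $ i $ j + a * of_bool (j = i) - y)"
      by (simp only: card_eq_sum_of_bool sum_distrib_left entry)
    also have "\<dots> = of_int k + a - y * real CARD('t)"
      by (simp add: sum.distrib sum_subtractf row of_bool_def if_distrib[of "(*) a"])
    finally show ?thesis using c by (simp add: field_simps)
  qed
  \<comment> \<open>Here \<open>z\<close> stands for the entry at \<open>(i, j)\<close>. By symmetry
    of C the two cross terms of the shifted product merge into \<open>2 * a * z\<close>, so the
    count depends on \<open>z\<close> alone.\<close>
  define F where "F z = (of_int mu * real n + (of_int (lam - mu) + 2 * a) * z
      - 2 * y * of_int k - 2 * a * y + y\<^sup>2 * real CARD('t)) / c\<^sup>2" for z
  have common: "real (card {s. E i s \<and> E j s}) = F (C $ i $ j)" if "i \<noteq> j" for i j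
  proof -
    \<comment> \<open>Scaling by \<open>c\<^sup>2\<close> gives each of the two indicators its own
      factor \<open>c\<close>, so that \<open>entry\<close> applies to both.\<close>
    have "c\<^sup>2 * real (card {s. E i s \<and> E j s}) =
        (\<Sum>s\<in>UNIV. (c * of_bool (E i s)) * (c * of_bool (E j s)))"
      unfolding card_eq_sum_of_bool sum_distrib_left
      by (rule sum.cong) (auto simp: power2_eq_square)
    also have "\<dots> = of_int mu * real n + (of_int (lam - mu) + 2 * a) * C $ i $ j
        - 2 * y * of_int k - 2 * a * y + y\<^sup>2 * real CARD('t)"
      unfolding entry sum_shifted_product[OF that] gram[OF that] row sym[of j i]
      by (simp add: algebra_simps)
    finally show ?thesis using c by (simp add: F_def field_simps)
  qed
  have "strongly_regular E CARD('t) (nat \<lfloor>(of_int k + a - y * real CARD('t)) / c\<rfloor>)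
      (nat \<lfloor>F x\<rfloor>) (nat \<lfloor>F y\<rfloor>)"
  proof (rule strongly_regularI_real)
    show "symp E" using sym by (auto simp: symp_def E_def)
    show "irreflp E" by (auto simp: irreflp_def E_def)
    show "real (card {s. E i s \<and> E j s}) = F x" if "E i j" for i j
      using that common[of i j] by (simp add: E_def)
    show "real (card {s. E i s \<and> E j s}) = F y" if "i \<noteq> j" "\<not> E i j" for i j
      using that common[of i j] vals[of i j] by (auto simp: E_def)
  qed (rule deg)
  \<comment> \<open>By \<open>vals\<close>, the fallback branch of \<open>replace_entries\<close> is
    never reached.\<close>
  moreover have "replace_entries x y C = adjacency_matrix E"
    using vals by (auto simp: replace_entries_def adjacency_matrix_def E_def vec_eq_iff)
  ultimately show ?thesis by blast
qed

end
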